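(* For every $x\in\mathbf{Q}_{>0}$ one has $$\mathrm{num}(x)=\mathsf{F}\left(\frac{\mathsf{F}(x)}{\mathsf{F}(1/x)}\right),$$ where $\mathsf F$ is the codenominator function and $\mathrm{num}$ is the numerator function.
   Context: The numerator function $\mathrm{num}:\mathbf{Q}_{>0}\to\mathbf{Z}_{>0}$ sends $x=p/q$ (with $p,q$ positive integers, $\gcd(p,q)=1$) to $p$. The codenominator $\mathsf{F}:\mathbf{Q}_{>0}\to\mathbf{Z}_{>0}$ is the unique function with $\mathsf{F}(1)=1$ satisfying, for all $x\in\mathbf{Q}_{>0}$, $\mathsf{F}(1+1/x)=\mathsf{F}(x)$ and $\mathsf{F}\left(\frac{1}{1+x}\right)=\mathsf{F}(x)+\mathsf{F}(1/x)$. *)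

theory Defs
  imports Complex_Main "HOL-Library.FuncSet"
begin

definition numerator :: "rat \<Rightarrow> int" where
  "numerator x = fst (quotient_of x)"

(* The set of extensional functions {0<..} \<rightarrow>\<^sub>E {0<..} fixes the value outside the positive
   rationals, so that the characterisation is unique on the whole type. *)
definition is_codenominator :: "(rat \<Rightarrow> int) \<Rightarrow> bool" where
  "is_codenominator F \<longleftrightarrow>
     F \<in> {0<..} \<rightarrow>\<^sub>E {0<..} \<and>
     F 1 = 1 \<and>
     (\<forall>x>0. F (1 + 1 / x) = F x) \<and>
     (\<forall>x>0. F (1 / (1 + x)) = F x + F (1 / x))"

definition codenominator :: "rat \<Rightarrow> int" where
  "codenominator = (THE F. is_codenominator F)"

(* Existence and uniqueness, by recursion on the sum of numerator and denominator. *)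

definition height :: "rat \<Rightarrow> nat" where
  "height x = nat (fst (quotient_of x) + snd (quotient_of x))"

lemma height_le:
  assumes "a > 0" "b > 0"
  shows "height (of_int a / of_int b) \<le> nat (a + b)"
proof -
  obtain p q where pq: "quotient_of (of_int a / of_int b) = (p, q)"
    by (cases "quotient_of (of_int a / of_int b)")
  have q: "q > 0" and cop: "coprime p q"
    using quotient_of_denom_pos[OF pq] quotient_of_coprime[OF pq] by auto
  have "of_int a / of_int b = (of_int p / of_int q :: rat)"
    using quotient_of_div[OF pq] by simp
  then have "(of_int (a * q) :: rat) = of_int (p * b)"
    using assms q by (simp add: field_simps)
  then have eq: "a * q = p * b"
    by (simp only: of_int_eq_iff)
  have "p dvd a * q" unfolding eq by simp
  then have pa: "p dvd a" using cop by (simp add: coprime_dvd_mult_left_iff)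
  have "q dvd p * b" unfolding eq[symmetric] by simp
  then have qb: "q dvd b"
    using cop by (simp add: coprime_dvd_mult_right_iff coprime_commute[of q p])
  from pa qb have "p \<le> a" "q \<le> b"
    using assms zdvd_imp_le by auto
  then show ?thesis
    unfolding height_def pq by simp
qed

lemma pos_rat_cases:
  fixes x :: rat
  assumes "x > 0"
  obtains p q where "p > 0" "q > 0" "x = of_int p / of_int q" "height x = nat (p + q)"
proof -
  obtain p q where pq: "quotient_of x = (p, q)"
    by (cases "quotient_of x")
  have q: "q > 0" using quotient_of_denom_pos[OF pq] .
  have x: "x = of_int p / of_int q" using quotient_of_div[OF pq] .
  have "p > 0" using assms q unfolding x by (simp add: zero_less_divide_iff)
  then show thesis using that q x pq by (simp add: height_def)
qed

lemma height_gt_1: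
  assumes "x > 1"
  shows "height (1 / (x - 1)) < height x"
proof -
  have "x > 0" using assms by simp
  then obtain p q where pq: "p > 0" "q > 0" "x = of_int p / of_int q" "height x = nat (p + q)"
    by (rule pos_rat_cases)
  have "p > q" using assms pq by (simp add: field_simps)
  moreover have "1 / (x - 1) = of_int q / of_int (p - q)"
    using pq(1,2) \<open>p > q\<close> unfolding pq(3) by (simp add: divide_simps)
  ultimately show ?thesis
    using height_le[of q "p - q"] pq by simp
qed

lemma height_less_1:
  assumes "0 < x" "x < 1"
  shows "height (1 / x - 1) < height x" "height (x / (1 - x)) < height x"
proof -
  have "x > 0" using assms by simp
  then obtain p q where pq: "p > 0" "q > 0" "x = of_int p / of_int q" "height x = nat (p + q)"
    by (rule pos_rat_cases)
  have "q > p" using assms pq by (simp add: field_simps)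
  moreover have "1 / x - 1 = of_int (q - p) / of_int p" "x / (1 - x) = of_int p / of_int (q - p)"
    using pq(1,2) \<open>q > p\<close> unfolding pq(3) by (simp_all add: divide_simps)
  ultimately show "height (1 / x - 1) < height x" "height (x / (1 - x)) < height x"
    using height_le[of "q - p" p] height_le[of p "q - p"] pq by simp_all
qed

function codenominator_rec :: "rat \<Rightarrow> int" where
  "codenominator_rec x =
     (if x \<le> 0 then undefined
      else if x = 1 then 1
      else if x > 1 then codenominator_rec (1 / (x - 1))
      else codenominator_rec (1 / x - 1) + codenominator_rec (x / (1 - x)))"
  by pat_completeness auto
termination
  by (relation "measure height") (auto intro: height_gt_1 height_less_1)

declare codenominator_rec.simps [simp del]

lemma codenominator_rec_nonpos: "x \<le> 0 \<Longrightarrow> codenominator_rec x = undefined"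
  by (subst codenominator_rec.simps) simp

lemma codenominator_rec_pos: "x > 0 \<Longrightarrow> codenominator_rec x > 0"
proof (induction x rule: codenominator_rec.induct)
  case (1 x)
  show ?case
  proof (cases "x \<ge> 1")
    case True
    then show ?thesis using 1 by (subst codenominator_rec.simps) auto
  next
    case False
    then have "1 / x - 1 > 0" "x / (1 - x) > 0" using 1 by (auto simp: field_simps)
    then show ?thesis using 1 False by (subst codenominator_rec.simps) (auto intro: add_pos_pos)
  qed
qed

lemma is_codenominator_rec: "is_codenominator codenominator_rec"
proof -
  have "codenominator_rec \<in> {0<..} \<rightarrow>\<^sub>E {0<..}"
    using codenominator_rec_pos by (auto simp: PiE_iff extensional_def codenominator_rec_nonpos)
  moreover have "codenominator_rec 1 = 1"
    by (subst codenominator_rec.simps) simp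
  moreover have "codenominator_rec (1 + 1 / x) = codenominator_rec x" if "x > 0" for x
  proof -
    have "\<not> 1 + 1 / x \<le> 0" "1 + 1 / x \<noteq> 1" "1 + 1 / x > 1" "1 / (1 + 1 / x - 1) = x"
      using that by (auto simp: field_simps)
    then show ?thesis by (subst codenominator_rec.simps) (simp only: if_False if_True)
  qed
  moreover have "codenominator_rec (1 / (1 + x)) = codenominator_rec x + codenominator_rec (1 / x)"
    if "x > 0" for x
  proof -
    have "\<not> 1 / (1 + x) \<le> 0" "1 / (1 + x) \<noteq> 1" "\<not> 1 / (1 + x) > 1"
      "1 / (1 / (1 + x)) - 1 = x" "(1 / (1 + x)) / (1 - 1 / (1 + x)) = 1 / x"
      using that by (auto simp: field_simps)
    then show ?thesis by (subst codenominator_rec.simps) (simp only: if_False)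
  qed
  ultimately show ?thesis unfolding is_codenominator_def by blast
qed

lemma is_codenominator_unique:
  assumes F: "is_codenominator F"
  shows "F = codenominator_rec"
proof
  fix x
  show "F x = codenominator_rec x"
  proof (induction x rule: codenominator_rec.induct)
    case (1 x)
    consider "x \<le> 0" | "x = 1" | "x > 1" | "0 < x" "x < 1" by linarith
    then show ?case
    proof cases
      case 1
      then have "F x = undefined"
        using F by (auto simp: is_codenominator_def PiE_iff extensional_def)
      then show ?thesis using 1 by (subst codenominator_rec.simps) simp
    next
      case 2
      then show ?thesis
        using F by (subst codenominator_rec.simps) (simp add: is_codenominator_def)
    next
      case 3
      then have "1 / (x - 1) > 0" "1 + 1 / (1 / (x - 1)) = x" by auto
      then have "F x = F (1 / (x - 1))"
        using F unfolding is_codenominator_def by metis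
      then show ?thesis
        using 3 "1.IH"(1) by (subst codenominator_rec.simps) simp
    next
      case 4
      then have "1 / x - 1 > 0" "1 / (1 + (1 / x - 1)) = x" "1 / (1 / x - 1) = x / (1 - x)"
        by (auto simp: field_simps)
      then have "F x = F (1 / x - 1) + F (x / (1 - x))"
        using F unfolding is_codenominator_def by metis
      then show ?thesis
        using 4 "1.IH"(2,3) by (subst codenominator_rec.simps) simp
    qed
  qed
qed

lemma ex1_is_codenominator: "\<exists>!F. is_codenominator F"
  using is_codenominator_rec is_codenominator_unique by blast

lemma is_codenominator_codenominator: "is_codenominator codenominator"
  unfolding codenominator_def by (rule theI'[OF ex1_is_codenominator])

end

(* The map J x = F x / F (1 / x) satisfies J (1 / x) = 1 / J x and J (1 + x) = 1 / (1 + J x), so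
   J \<circ> J fixes 1 and commutes with both 1 / x and 1 + x. These two maps generate all positive
   rationals from 1, hence J is an involution. By the same generation argument F x and F (1 / x)
   are coprime, i.e. num (J x) = F x; apply this to J x in place of x. *)

theory Submission imports Defs begin

text \<open>The two generators undo the subtractive Euclidean algorithm, which ends at 1 because
  \<open>height\<close> drops; the bounds behind the termination of \<open>codenominator_rec\<close>
  serve again here.\<close>

lemma pos_rat_induct [consumes 1, case_names one inverse add_one]:
  fixes x :: rat
  assumes "x > 0"
    and one: "P 1"
    and inverse: "\<And>x. x > 0 \<Longrightarrow> P x \<Longrightarrow> P (1 / x)"
    and add_one: "\<And>x. x > 0 \<Longrightarrow> P x \<Longrightarrow> P (1 + x)"
  shows "P x"
  using \<open>x > 0\<close>
proof (induction x rule: measure_induct_rule[of height])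
  case (less x)
  consider "x = 1" | "x > 1" | "x < 1" by linarith
  then show ?case
  proof cases
    case 1
    then show ?thesis using one by simp
  next
    case 2
    \<comment> \<open>The height bound at hand concerns \<open>1 / (x - 1)\<close>, not
      \<open>x - 1\<close>; one inversion makes up for it.\<close>
    then have "P (1 / (x - 1))" using less.IH[OF height_gt_1] by simp
    then show ?thesis
      using 2 inverse[of "1 / (x - 1)"] add_one[of "x - 1"] by simp
  next
    case 3
    with less.prems have pos: "1 / x - 1 > 0" by (simp add: field_simps)
    then have "P (1 / x - 1)" using less.IH[OF height_less_1(1)] less.prems 3 by simp
    then show ?thesis
      using pos less.prems add_one[of "1 / x - 1"] inverse[of "1 / x"] by simp
  qed
qed

lemma codenominator_pos: "x > 0 \<Longrightarrow> codenominator x > 0"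
  using is_codenominator_codenominator by (auto simp: is_codenominator_def)

lemma codenominator_1: "codenominator 1 = 1"
  using is_codenominator_codenominator by (simp add: is_codenominator_def)

text \<open>The defining equation for \<open>1 + 1 / x\<close>, taken at \<open>1 / x\<close> to fit
  the case \<open>add_one\<close> of the induction.\<close>

lemma codenominator_add_one: "x > 0 \<Longrightarrow> codenominator (1 + x) = codenominator (1 / x)"
  using is_codenominator_codenominator unfolding is_codenominator_def
  by (metis div_by_1 divide_divide_eq_right mult_1 zero_less_divide_1_iff)

lemma codenominator_inverse_add_one:
  "x > 0 \<Longrightarrow> codenominator (1 / (1 + x)) = codenominator x + codenominator (1 / x)"
  using is_codenominator_codenominator by (simp add: is_codenominator_def)

text \<open>Inversion swaps the two values, and adding one to \<open>x\<close> turns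
  \<open>(a, b)\<close> into \<open>(b, a + b)\<close>; both keep the gcd.\<close>

lemma coprime_codenominator_inverse:
  "x > 0 \<Longrightarrow> coprime (codenominator x) (codenominator (1 / x))"
proof (induction x rule: pos_rat_induct)
  case one
  show ?case by (simp add: codenominator_1)
next
  case (inverse x)
  then show ?case by (simp add: coprime_commute)
next
  case (add_one x)
  then have "coprime (codenominator (1 / x)) (codenominator x + codenominator (1 / x))"
    by (simp add: coprime_iff_gcd_eq_1 add.commute[of "codenominator x"] gcd.commute[of "codenominator x"])
  with add_one show ?case
    by (simp add: codenominator_add_one codenominator_inverse_add_one)
qed

definition jimm :: "rat \<Rightarrow> rat" where
  "jimm x = rat_of_int (codenominator x) / rat_of_int (codenominator (1 / x))"

lemma jimm_pos: "x > 0 \<Longrightarrow> jimm x > 0"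
  by (simp add: jimm_def codenominator_pos)

lemma jimm_1: "jimm 1 = 1"
  by (simp add: jimm_def codenominator_1)

lemma jimm_inverse: "jimm (1 / x) = 1 / jimm x"
  by (simp add: jimm_def)

lemma jimm_add_one:
  assumes "x > 0"
  shows "jimm (1 + x) = 1 / (1 + jimm x)"
  using codenominator_pos[of x] codenominator_pos[of "1 / x"] assms
  by (simp add: jimm_def codenominator_add_one codenominator_inverse_add_one field_simps)

lemma jimm_jimm: "x > 0 \<Longrightarrow> jimm (jimm x) = x"
proof (induction x rule: pos_rat_induct)
  case (add_one x)
  \<comment> \<open>With J for \<open>jimm\<close>: \<open>J (J (1 + x)) = J (1 / (1 + J x)) = 1 / J
    (1 + J x) = 1 + J (J x)\<close>; the last equality uses \<open>jimm_add_one\<close> at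
    \<open>jimm x\<close>, which is positive.\<close>
  then show ?case by (simp add: jimm_add_one jimm_inverse jimm_pos)
qed (simp_all add: jimm_1 jimm_inverse)

lemma numerator_divide:
  assumes "coprime a b" "b > 0"
  shows "numerator (rat_of_int a / rat_of_int b) = a"
  using assms by (simp add: numerator_def quotient_of_Fract normalize_stable flip: Fract_of_int_quotient)

lemma numerator_jimm: "x > 0 \<Longrightarrow> numerator (jimm x) = codenominator x"
  by (simp add: jimm_def numerator_divide coprime_codenominator_inverse codenominator_pos)

theorem theorem1:
  fixes x :: rat
  assumes "x > 0"
  shows "numerator x =
    codenominator (rat_of_int (codenominator x) / rat_of_int (codenominator (1 / x)))"
  using numerator_jimm[OF jimm_pos[OF assms]] jimm_jimm[OF assms] by (simp add: jimm_def)

end
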